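(* Let $\phi(x,z)$ be an associate of $F_{\mathrm{add}}(x,y)=x+y$ and let $f(x)\in x\mathbb{C}[[x]]$ with $f'(0)\neq0$. Define $\phi_f(x,z)=f^{-1}(\phi(f(x),z))$. Then $\phi_f(x,z)$ is an associate of $F_{\mathrm{add}}(x,y)$.
   Context: An associate of $F_{\mathrm{add}}(x,y)=x+y$ is a formal series $\phi(x,z)\in\mathbb{C}((x))[[z]]$ satisfying $\phi(x,0)=x$ and $\phi(\phi(x,y),z)=\phi(x,y+z)$. For $f(x)\in x\mathbb{C}[[x]]$ with $f'(0)\neq 0$, $f^{-1}(x)\in x\mathbb{C}[[x]]$ denotes the inverse with respect to composition: $f(f^{-1}(x))=x=f^{-1}(f(x))$. *)

theory Defs
  imports
    Complex_Main
    "HOL-Library.Groups_Big_Fun"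
    "HOL-Computational_Algebra.Formal_Laurent_Series"
begin

text \<open>
  An element of \<open>C((x))[[z]]\<close> is a value of type \<open>complex fls fps\<close>: the outer power series variable
  is \<open>z\<close>, and \<open>fps_nth \<phi> n\<close> is the coefficient of \<open>z^n\<close>, a Laurent series in \<open>x\<close>.
  An element of \<open>C((x))[[y,z]]\<close> is a value of type \<open>complex fls fps fps\<close>: the outer variable is
  \<open>z\<close>, the inner power series variable is \<open>y\<close>.
\<close>

text \<open>
  \<open>g(\<psi>(x,y)) = \<Sum>m. g_m \<psi>(x,y)^m\<close> for \<open>g\<close> in \<open>C((x))\<close> and \<open>\<psi>\<close> in \<open>C((x))[[y]]\<close>. It makes sense
  when \<open>\<psi>(x,0)\<close> is nonzero and lies in \<open>x C[[x]]\<close>. Then \<open>\<psi>\<close> is a unit of \<open>C((x))[[y]]\<close>, so its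
  negative powers exist, and for each \<open>i\<close> there are a \<open>d > 0\<close> (the order of \<open>\<psi>(x,0)\<close>) and a \<open>c\<close>
  such that the coefficient of \<open>y^i\<close> in \<open>\<psi>^m\<close> has order at least \<open>d * m - c\<close> for every \<open>m\<close>.
  Hence only finitely many \<open>m\<close> contribute to each coefficient of \<open>x^k y^i\<close>, and none does for \<open>k\<close>
  sufficiently negative. The sum is not finite in \<open>complex fls\<close>, so it is taken coefficientwise.
\<close>
definition fls_subst :: "complex fls \<Rightarrow> complex fls fps \<Rightarrow> complex fls fps" where
  "fls_subst g \<psi> = Abs_fps (\<lambda>i. Abs_fls (\<lambda>k.
     Sum_any (\<lambda>m::int. fls_nth g m * fls_nth (fps_nth (\<psi> powi m) i) k)))"

text \<open>\<open>\<phi>(\<psi>(x,y),z)\<close>\<close>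
definition subst_x :: "complex fls fps \<Rightarrow> complex fls fps \<Rightarrow> complex fls fps fps" where
  "subst_x \<phi> \<psi> = Abs_fps (\<lambda>n. fls_subst (fps_nth \<phi> n) \<psi>)"

text \<open>
  \<open>\<phi>(x,y+z) = \<Sum>n. \<phi>_n(x) (y+z)^n\<close>, where \<open>fps_const fps_X\<close> is \<open>y\<close> and \<open>fps_X\<close> is \<open>z\<close>. The
  coefficient of \<open>y^i z^j\<close> receives a contribution only from \<open>n = i + j\<close>. The library's
  \<open>fps_compose\<close> does not apply, since \<open>y + z\<close> has nonzero constant term \<open>y\<close> as a series in \<open>z\<close>.
\<close>
definition subst_add :: "complex fls fps \<Rightarrow> complex fls fps fps" where
  "subst_add \<phi> = Abs_fps (\<lambda>j. Abs_fps (\<lambda>i.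
     Sum_any (\<lambda>n::nat. fps_nth \<phi> n * fps_nth (fps_nth ((fps_const fps_X + fps_X) ^ n) j) i)))"

definition additive_associate :: "complex fls fps \<Rightarrow> bool" where
  "additive_associate \<phi> \<longleftrightarrow> fps_nth \<phi> 0 = fls_X \<and> subst_x \<phi> \<phi> = subst_add \<phi>"

text \<open>\<open>f^{-1}(\<phi>(f(x),z))\<close>, where \<open>fps_inv\<close> is the compositional inverse\<close>
definition conj_associate :: "complex fps \<Rightarrow> complex fls fps \<Rightarrow> complex fls fps" where
  "conj_associate f \<phi> = fls_subst (fps_to_fls (fps_inv f))
     (Abs_fps (\<lambda>n. fls_compose_fps (fps_nth \<phi> n) f))"

end

theory Submission
  imports Defs
begin

text \<open>
  The additive associates are exactly the flows \<open>exp(z a D) x\<close> of the derivations \<open>a D\<close> of \<open>C((x))\<close>,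
  where \<open>D = d/dx\<close> and \<open>a = \<phi>_1\<close>: the coefficient of \<open>y\<close> in \<open>\<phi>(\<phi>(x,y),z) = \<phi>(x,y+z)\<close> gives the recursion
  \<open>(n+1) \<phi>_{n+1} = a \<phi>_n'\<close>, and conversely \<open>exp(z a D)\<close> is a continuous ring homomorphism, so that
  \<open>g(exp(z a D) u) = exp(z a D) g(u)\<close>. By the chain rule, composition with \<open>f\<close> intertwines \<open>a D\<close> with
  \<open>b D\<close> for \<open>b = a(f) / f'\<close>. Hence \<open>\<phi>_f = f^{-1}(exp(z b D) f) = exp(z b D) x\<close>.
\<close>

unbundle fps_syntax

section \<open>Flows of derivations on Laurent series\<close>

definition deriv_along :: "'a::field_char_0 fls \<Rightarrow> 'a fls \<Rightarrow> 'a fls" where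
  "deriv_along a u = a * fls_deriv u"

text \<open>The exponential series \<open>exp(z a D) u\<close>, with \<open>z\<close> the power
  series variable.\<close>

definition flow :: "'a::field_char_0 fls \<Rightarrow> 'a fls \<Rightarrow> 'a fls fps" where
  "flow a u = Abs_fps (\<lambda>n. (deriv_along a ^^ n) u / fact n)"

lemma inverse_fact_fls: "inverse (fact n) = (fls_const (inverse (fact n)) :: 'a::field_char_0 fls)"
  by (metis fls_inverse_const fls_of_nat of_nat_fact)

lemma flow_nth: "flow a u $ n = (deriv_along a ^^ n) u / fact n"
  by (simp add: flow_def)

lemma deriv_along_add: "deriv_along a (u + v) = deriv_along a u + deriv_along a v"
  by (simp add: deriv_along_def algebra_simps)

lemma deriv_along_mult: "deriv_along a (u * v) = deriv_along a u * v + u * deriv_along a v"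
  by (simp add: deriv_along_def algebra_simps)

lemma deriv_along_const_mult: "deriv_along a (fls_const c * u) = fls_const c * deriv_along a u"
  by (simp add: deriv_along_def algebra_simps)

lemma funpow_deriv_along_add:
  "(deriv_along a ^^ n) (u + v) = (deriv_along a ^^ n) u + (deriv_along a ^^ n) v"
  by (induction n) (simp_all add: deriv_along_add)

lemma funpow_deriv_along_const_mult:
  "(deriv_along a ^^ n) (fls_const c * u) = fls_const c * (deriv_along a ^^ n) u"
  by (induction n) (simp_all add: deriv_along_const_mult)

lemma deriv_along_divide_fact: "deriv_along a (u / fact k) = deriv_along a u / fact k"
  using deriv_along_const_mult[of a "inverse (fact k)" u]
  by (simp add: inverse_fact_fls divide_inverse mult.commute)

lemma funpow_deriv_along_divide_fact:
  "(deriv_along a ^^ n) (u / fact k) = (deriv_along a ^^ n) u / fact k"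
  by (induction n) (simp_all add: deriv_along_divide_fact)

lemma flow_add: "flow a (u + v) = flow a u + flow a v"
  by (rule fps_ext) (simp add: flow_nth funpow_deriv_along_add add_divide_distrib)

lemma flow_0 [simp]: "flow a u $ 0 = u"
  by (simp add: flow_nth)

lemma fps_deriv_flow: "fps_deriv (flow a u) = flow a (deriv_along a u)"
proof (rule fps_ext)
  fix n
  have "of_nat (Suc n) * (w / fact (Suc n)) = w / fact n" for w :: "'a fls"
    unfolding fact_Suc by (simp add: divide_simps del: of_nat_Suc)
  thus "fps_deriv (flow a u) $ n = flow a (deriv_along a u) $ n"
    by (simp add: flow_nth funpow_swap1 del: of_nat_Suc fact_Suc)
qed

text \<open>By the Leibniz rule both sides satisfy the same differential equation in
  \<open>z\<close>. Coefficient \<open>Suc n\<close> reduces to coefficient \<open>n\<close> with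
  one factor differentiated, hence the induction over all \<open>u\<close> and
  \<open>v\<close>.\<close>

lemma flow_mult: "flow a (u * v) = flow a u * flow a v"
proof -
  have "(flow a u * flow a v) $ n = flow a (u * v) $ n" for n
  proof (induction n arbitrary: u v)
    case 0
    show ?case by simp
  next
    case (Suc n)
    have "of_nat (Suc n) * (flow a u * flow a v) $ Suc n = fps_deriv (flow a u * flow a v) $ n"
      by (simp only: fps_deriv_nth Suc_eq_plus1)
    also have "\<dots> = (flow a u * flow a (deriv_along a v)) $ n + (flow a (deriv_along a u) * flow a v) $ n"
      by (simp add: fps_deriv_flow)
    also have "\<dots> = flow a (deriv_along a (u * v)) $ n"
      by (simp add: Suc.IH deriv_along_mult flow_add add.commute)
    also have "\<dots> = of_nat (Suc n) * flow a (u * v) $ Suc n"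
      by (simp only: fps_deriv_nth Suc_eq_plus1 flip: fps_deriv_flow)
    finally show ?case
      by (simp del: of_nat_Suc)
  qed
  thus ?thesis by (simp add: fps_eq_iff)
qed

lemma flow_1 [simp]: "flow a 1 = 1"
proof (rule fps_ext)
  fix n
  have "(deriv_along a ^^ m) (deriv_along a 1) = 0" for m
    by (induction m) (simp_all add: deriv_along_def)
  thus "flow a 1 $ n = 1 $ n"
    by (cases n) (simp_all add: flow_nth funpow_swap1)
qed

lemma flow_power: "flow a (u ^ n) = flow a u ^ n"
  by (induction n) (simp_all add: flow_mult)

lemma flow_power_int:
  assumes "u \<noteq> 0"
  shows "flow a (u powi m) = flow a u powi m"
proof -
  have "flow a u * flow a (inverse u) = 1"
    using assms by (simp flip: flow_mult)
  hence "flow a (inverse u) = inverse (flow a u)"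
    by (rule fps_inverse_unique[symmetric])
  thus ?thesis
    by (simp add: power_int_def flow_power)
qed

section \<open>Substitution of a flow into a Laurent series\<close>

text \<open>
  Convergence of \<open>\<Sum>m. u_m\<close> to \<open>s\<close> at a linear rate in the order of the remainder. A differential
  operator lowers orders by at most a constant and so preserves this.
\<close>
definition expansion :: "(int \<Rightarrow> 'a::ring_1 fls) \<Rightarrow> 'a fls \<Rightarrow> bool" where
  "expansion u s \<longleftrightarrow> (\<exists>l c. (\<forall>m<l. u m = 0) \<and>
     (\<forall>M. \<forall>k<M - c. (s - (\<Sum>m=l..<M. u m)) $$ k = 0))"

lemma
  assumes "expansion u s"
  shows expansion_nth: "Sum_any (\<lambda>m. u m $$ k) = s $$ k"
    and expansion_finite: "finite {m. u m $$ k \<noteq> 0}"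
proof -
  obtain l c where l: "\<And>m. m < l \<Longrightarrow> u m = 0"
    and c: "\<And>M k. k < M - c \<Longrightarrow> (s - (\<Sum>m=l..<M. u m)) $$ k = 0"
    using assms unfolding expansion_def by blast
  \<comment> \<open>The least \<open>M\<close> whose remainder is known to vanish at
    \<open>k\<close>. For \<open>m \<ge> M\<close> the remainders at \<open>m\<close> and
    \<open>m + 1\<close> both vanish there, and they differ by \<open>u m\<close>.\<close>
  define M where "M = k + c + 1"
  have zero: "u m $$ k = 0" if "m \<ge> M" for m
  proof (cases "m < l")
    case False
    have "{l..<m + 1} = insert m {l..<m}"
      using False by auto
    with c[of k m] c[of k "m + 1"] that show ?thesis
      by (simp add: M_def)
  qed (simp add: l)
  have sub: "{m. u m $$ k \<noteq> 0} \<subseteq> {l..<M}"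
    using l zero by (force simp: not_less[symmetric])
  thus "finite {m. u m $$ k \<noteq> 0}"
    by (rule finite_subset) simp
  have "Sum_any (\<lambda>m. u m $$ k) = (\<Sum>m=l..<M. u m $$ k)"
    using sub by (intro Sum_any.expand_superset) simp_all
  also have "\<dots> = (\<Sum>m=l..<M. u m) $$ k"
    by (rule fls_nth_sum[symmetric])
  also have "\<dots> = s $$ k"
    using c[of k M] by (simp add: M_def)
  finally show "Sum_any (\<lambda>m. u m $$ k) = s $$ k" .
qed

text \<open>Bounding the order of \<open>t\<close> through vanishing coefficients covers
  \<open>t = 0\<close>, whose \<open>fls_subdegree\<close> is 0 by convention.\<close>

lemma fls_times_nth_eq0':
  fixes a t :: "'a::semiring_0 fls"
  assumes "\<And>j. j < N \<Longrightarrow> t $$ j = 0" "k < fls_subdegree a + N"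
  shows "(a * t) $$ k = 0"
proof (cases "t = 0")
  case False
  hence "N \<le> fls_subdegree t"
    using assms(1) by (rule fls_subdegree_geI)
  thus ?thesis
    using assms(2) by (intro fls_times_nth_eq0) simp
qed simp

lemma expansion_deriv_along:
  assumes "expansion u s"
  shows "expansion (\<lambda>m. deriv_along a (u m)) (deriv_along a s)"
proof -
  obtain l c where l: "\<And>m. m < l \<Longrightarrow> u m = 0"
    and c: "\<And>M k. k < M - c \<Longrightarrow> (s - (\<Sum>m=l..<M. u m)) $$ k = 0"
    using assms unfolding expansion_def by blast
  \<comment> \<open>Differentiation lowers the order of the remainder by at most one, and
    multiplication by \<open>a\<close> raises it by at least \<open>fls_subdegree a\<close>.\<close>
  have "(deriv_along a s - (\<Sum>m=l..<M. deriv_along a (u m))) $$ k = 0"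
    if "k < M - (c + 1 - fls_subdegree a)" for M k
  proof -
    have "deriv_along a s - (\<Sum>m=l..<M. deriv_along a (u m))
        = a * fls_deriv (s - (\<Sum>m=l..<M. u m))"
      by (simp add: deriv_along_def fls_deriv_sum sum_distrib_left algebra_simps)
    also have "\<dots> $$ k = 0"
      by (rule fls_times_nth_eq0'[where N = "M - c - 1"]) (use c that in auto)
    finally show ?thesis .
  qed
  moreover have "\<forall>m<l. deriv_along a (u m) = 0"
    by (simp add: l deriv_along_def)
  ultimately show ?thesis
    unfolding expansion_def by blast
qed

lemma expansion_funpow_deriv_along:
  assumes "expansion u s"
  shows "expansion (\<lambda>m. (deriv_along a ^^ n) (u m)) ((deriv_along a ^^ n) s)"
  using assms by (induction n) (simp_all add: expansion_deriv_along)

text \<open>The remainder is \<open>r\<close> composed with \<open>f\<close>, where \<open>r\<close>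
  is the remainder of \<open>g\<close> itself, and composition multiplies orders by
  \<open>subdegree f \<ge> 1\<close>.\<close>

lemma expansion_fls_compose_fps:
  assumes f: "f \<noteq> 0" "f $ 0 = 0"
  shows "expansion (\<lambda>m. fls_const (g $$ m) * fps_to_fls f powi m) (fls_compose_fps g f)"
proof -
  define l where "l = fls_subdegree g"
  define d where "d = int (subdegree f)"
  have d: "d \<ge> 1"
    using f subdegree_pos_iff[of f] by (simp add: d_def)
  have "(fls_compose_fps g f - (\<Sum>m=l..<M. fls_const (g $$ m) * fps_to_fls f powi m)) $$ k = 0"
    if k: "k < M - \<bar>l\<bar> * d" for M k
  proof -
    define r where "r = g - (\<Sum>m=l..<M. fls_const (g $$ m) * fls_X powi m)"
    have comp_sum: "fls_compose_fps (\<Sum>m\<in>A. h m) f = (\<Sum>m\<in>A. fls_compose_fps (h m) f)"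
      if "finite A" for A and h :: "int \<Rightarrow> 'a fls"
      using that by induction (simp_all add: fls_compose_fps_add f)
    have eq: "fls_compose_fps g f - (\<Sum>m=l..<M. fls_const (g $$ m) * fps_to_fls f powi m)
        = fls_compose_fps r f"
      by (simp add: r_def fls_compose_fps_diff comp_sum fls_compose_fps_mult fls_compose_fps_powi f
          del: fls_X_power_int)
    have r0: "r $$ j = 0" if "j < max l M" for j
    proof -
      have "r $$ j = g $$ j - (\<Sum>m=l..<M. if m = j then g $$ j else 0)"
        by (simp add: r_def fls_nth_sum if_distrib cong: if_cong)
      also have "\<dots> = 0"
        using that by (auto simp: l_def)
      finally show ?thesis .
    qed
    show ?thesis
    proof (cases "r = 0")
      case False
      hence s: "max l M \<le> fls_subdegree r"
        using r0 by (rule fls_subdegree_geI)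
      \<comment> \<open>A nonnegative order does not drop when multiplied by \<open>d\<close>; a
        negative one is at least \<open>l\<close>, so its multiple is at least
        \<open>- \<bar>l\<bar> * d\<close>.\<close>
      have "M - \<bar>l\<bar> * d \<le> fls_subdegree r * d"
      proof (cases "fls_subdegree r \<ge> 0")
        case True
        have "M \<le> fls_subdegree r * 1" using s by simp
        also have "\<dots> \<le> fls_subdegree r * d" 
          using d True by (intro mult_left_mono) auto
        finally show ?thesis
          using d by (smt (verit) mult_nonneg_nonneg)
      next
        case False
        have "- \<bar>l\<bar> * d \<le> fls_subdegree r * d"
          using d s by (intro mult_right_mono) auto
        thus ?thesis using False s by simp
      qed
      thus ?thesis
        using k f by (simp add: eq d_def)
    qed (simp add: eq)
  qed
  moreover have "\<forall>m<l. fls_const (g $$ m) * fps_to_fls f powi m = 0"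
    by (simp add: l_def)
  ultimately show ?thesis
    unfolding expansion_def by blast
qed

lemma fls_compose_fps_X_right [simp]: "fls_compose_fps g fps_X = g"
  using fls_nth_fls_compose_fps_linear[of 1 g] by (simp add: fls_eq_iff)

text \<open>As \<open>flow a\<close> is multiplicative, each coefficient of
  \<open>flow a F powi m\<close> is a differential operator applied to \<open>F powi m\<close>, so
  the expansion of \<open>fls_compose_fps g f\<close> may be differentiated termwise.\<close>

lemma fls_subst_flow:
  assumes f: "f \<noteq> 0" "f $ 0 = 0"
  shows "fls_subst g (flow a (fps_to_fls f)) = flow a (fls_compose_fps g f)"
proof (rule fps_ext)
  fix i
  let ?F = "fps_to_fls f" and ?L = "deriv_along a ^^ i"
  have "Sum_any (\<lambda>m. g $$ m * (flow a ?F powi m) $ i $$ k) = flow a (fls_compose_fps g f) $ i $$ k" for k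
  proof -
    let ?u = "\<lambda>m. ?L (fls_const (g $$ m) * ?F powi m)"
    have "g $$ m * (flow a ?F powi m) $ i $$ k = ?u m $$ k * inverse (fact i)" for m
      by (simp add: f flow_nth divide_inverse inverse_fact_fls funpow_deriv_along_const_mult flip: flow_power_int)
    moreover have "Sum_any (\<lambda>m. ?u m $$ k) = ?L (fls_compose_fps g f) $$ k"
      by (intro expansion_nth expansion_funpow_deriv_along expansion_fls_compose_fps f)
    moreover have "finite {m. ?u m $$ k \<noteq> 0}"
      by (rule expansion_finite[OF expansion_funpow_deriv_along[OF expansion_fls_compose_fps[OF f]]])
    ultimately show ?thesis
      by (simp add: flow_nth divide_inverse inverse_fact_fls flip: Sum_any_left_distrib)
  qed
  \<comment> \<open>The coefficients are those of an actual Laurent series, so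
    \<open>Abs_fls\<close> recovers it.\<close>
  thus "fls_subst g (flow a ?F) $ i = flow a (fls_compose_fps g f) $ i"
    by (simp add: fls_subst_def fls_nth_inverse)
qed

section \<open>Additive associates as flows\<close>

lemma fps_power_int_nth_1:
  fixes \<psi> :: "'a::field fps"
  assumes "\<psi> $ 0 \<noteq> 0"
  shows "(\<psi> powi m) $ 1 = of_int m * (\<psi> $ 0) powi (m - 1) * \<psi> $ 1"
proof -
  \<comment> \<open>At \<open>n = 0\<close> the truncated exponent \<open>n - 1\<close> is harmless
    because the factor \<open>of_nat n\<close> vanishes.\<close>
  have pow: "(\<chi> ^ n) $ 1 = of_nat n * (\<chi> $ 0) ^ (n - 1) * \<chi> $ 1" for \<chi> :: "'a fps" and n
  proof -
    have "(\<chi> ^ n) $ 1 = fps_deriv (\<chi> ^ n) $ 0" by simp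
    also have "\<dots> = of_nat n * (\<chi> $ 0) ^ (n - 1) * \<chi> $ 1"
      by (simp add: fps_deriv_power fps_power_zeroth)
    finally show ?thesis .
  qed
  show ?thesis
  proof (cases m rule: int_cases4)
    case (nonneg n)
    thus ?thesis using pow[of \<psi> n]
      by (cases n) (simp_all add: power_int_def nat_add_distrib del: power_Suc)
  next
    case (neg n)
    have "inverse \<psi> $ 1 = fps_deriv (inverse \<psi>) $ 0" by simp
    also have "\<dots> = - (inverse (\<psi> $ 0) ^ 2 * \<psi> $ 1)"
      using assms by (simp add: fps_inverse_deriv power2_eq_square)
    finally have inv: "inverse \<psi> $ 1 = - (inverse (\<psi> $ 0) ^ 2 * \<psi> $ 1)" .
    have "n - 1 + 2 = nat (1 - m)"
      using neg by simp
    hence "(\<psi> $ 0) powi (m - 1) = inverse (\<psi> $ 0) ^ (n - 1) * inverse (\<psi> $ 0) ^ 2"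
      using neg by (simp add: power_int_def flip: power_add)
    moreover have "\<psi> powi m = inverse \<psi> ^ n"
      using neg by (simp add: power_int_def)
    ultimately show ?thesis
      using neg pow[of "inverse \<psi>" n] assms inv by simp
  qed
qed

text \<open>First-order Taylor expansion: \<open>g(x + a y + ...) = g + a g' y + ...\<close>. It
  extracts the generator of an associate.\<close>

lemma fls_subst_nth_1:
  assumes "\<psi> $ 0 = fls_X"
  shows "fls_subst g \<psi> $ 1 = deriv_along (\<psi> $ 1) g"
proof -
  have "expansion (\<lambda>m. deriv_along (\<psi> $ 1) (fls_const (g $$ m) * fls_X powi m)) (deriv_along (\<psi> $ 1) g)"
    using expansion_deriv_along[OF expansion_fls_compose_fps[of fps_X g]] by simp
  moreover have "(deriv_along (\<psi> $ 1) (fls_const (g $$ m) * fls_X powi m)) $$ k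
      = g $$ m * (\<psi> powi m) $ 1 $$ k" for m k
  proof -
    have "(\<psi> powi m) $ 1 = deriv_along (\<psi> $ 1) (fls_X powi m)"
      by (subst fps_power_int_nth_1)
        (simp_all add: assms deriv_along_def fls_deriv_X_intpow mult_ac del: One_nat_def)
    thus ?thesis
      by (simp add: deriv_along_const_mult)
  qed
  ultimately have "Sum_any (\<lambda>m. g $$ m * (\<psi> powi m) $ 1 $$ k) = deriv_along (\<psi> $ 1) g $$ k" for k
    using expansion_nth by fastforce
  thus ?thesis
    by (simp add: fls_subst_def fls_nth_inverse)
qed

lemma subst_add_nth: "subst_add \<phi> $ j $ i = of_nat ((i + j) choose j) * \<phi> $ (i + j)"
proof -
  have *: "((fps_const fps_X + fps_X :: complex fls fps fps) ^ n) $ j $ i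
      = (if n = i + j then of_nat ((i + j) choose j) else 0)" for n
  proof -
    \<comment> \<open>With the summands swapped, \<open>binomial_ring\<close> puts the exponent
      \<open>k\<close> on the outer variable, which selects \<open>k = j\<close>.\<close>
    have "((fps_X + fps_const fps_X :: complex fls fps fps) ^ n) $ j
        = (\<Sum>k\<le>n. if k = j then of_nat (n choose j) * fps_X ^ (n - j) else 0)"
      unfolding binomial_ring fps_sum_nth
      by (intro sum.cong refl)
        (simp add: mult_ac fps_X_power_mult_nth flip: fps_of_nat)
    also have "\<dots> $ i = (if n = i + j then of_nat ((i + j) choose j) else 0)"
      by auto
    finally show ?thesis
      by (simp add: add.commute)
  qed
  have "subst_add \<phi> $ j $ i
      = Sum_any (\<lambda>n. if n = i + j then of_nat ((i + j) choose j) * \<phi> $ (i + j) else 0)"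
    by (simp add: subst_add_def * if_distrib mult_ac cong: if_cong del: Sum_any.delta)
  thus ?thesis by simp
qed

lemma additive_associate_iff_flow:
  "additive_associate \<phi> \<longleftrightarrow> (\<exists>a. \<phi> = flow a fls_X)"
proof
  assume "additive_associate \<phi>"
  hence 0: "\<phi> $ 0 = fls_X" and eq: "subst_x \<phi> \<phi> = subst_add \<phi>"
    by (simp_all add: additive_associate_def)
  \<comment> \<open>Compare coefficients of \<open>y z^n\<close>; the binomial coefficient in
    \<open>subst_add\<close> is then \<open>Suc n choose n = Suc n\<close>.\<close>
  have rec: "of_nat (Suc n) * \<phi> $ Suc n = deriv_along (\<phi> $ 1) (\<phi> $ n)" for n
  proof -
    have "subst_x \<phi> \<phi> $ n $ 1 = deriv_along (\<phi> $ 1) (\<phi> $ n)"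
      by (simp add: subst_x_def fls_subst_nth_1 0 flip: One_nat_def)
    thus ?thesis
      by (simp add: eq subst_add_nth)
  qed
  have "\<phi> $ n = flow (\<phi> $ 1) fls_X $ n" for n
  proof (induction n)
    case (Suc n)
    have "of_nat (Suc n) * \<phi> $ Suc n = deriv_along (\<phi> $ 1) ((deriv_along (\<phi> $ 1) ^^ n) fls_X / fact n)"
      using rec[of n] Suc by (simp add: flow_nth)
    hence "of_nat (Suc n) * \<phi> $ Suc n = (deriv_along (\<phi> $ 1) ^^ Suc n) fls_X / fact n"
      by (simp add: deriv_along_divide_fact del: of_nat_Suc)
    thus ?case
      by (simp add: flow_nth divide_simps mult_ac del: of_nat_Suc)
  qed (simp add: 0)
  thus "\<exists>a. \<phi> = flow a fls_X"
    by (blast intro: fps_ext)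
next
  assume "\<exists>a. \<phi> = flow a fls_X"
  then obtain a where a: "\<phi> = flow a fls_X" ..
  \<comment> \<open>The case \<open>f = fps_X\<close> turns substitution of \<open>\<phi>\<close>
    into \<open>flow a\<close>, so the associate law becomes the addition law of the
    exponential.\<close>
  have subst: "fls_subst g \<phi> = flow a g" for g
    using fls_subst_flow[of fps_X g a] by (simp add: a)
  have "subst_x \<phi> \<phi> $ n $ i = subst_add \<phi> $ n $ i" for n i
  proof -
    have "subst_x \<phi> \<phi> $ n $ i = flow a (flow a fls_X $ n) $ i"
      by (simp add: subst_x_def subst) (simp add: a)
    also have "\<dots> = (deriv_along a ^^ (i + n)) fls_X / (fact n * fact i)"
      by (simp add: flow_nth funpow_deriv_along_divide_fact funpow_add)
    also have "\<dots> = of_nat ((i + n) choose n) * ((deriv_along a ^^ (i + n)) fls_X / fact (i + n))"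
      by (simp add: binomial_fact)
    also have "\<dots> = subst_add \<phi> $ n $ i"
      by (simp add: subst_add_nth a flow_nth)
    finally show ?thesis .
  qed
  thus "additive_associate \<phi>"
    by (simp add: additive_associate_def fps_eq_iff a)
qed

section \<open>Change of variable by a power series\<close>

text \<open>A power \<open>q\<close> of \<open>fps_X\<close> clears the pole of \<open>g\<close>.
  The power series chain rule for \<open>q\<close> and \<open>g * q\<close>, with the product rule,
  yields the claim after cancelling \<open>fls_compose_fps q f\<close>.\<close>

lemma fls_deriv_fls_compose_fps:
  fixes g :: "'a::field fls"
  assumes f: "f \<noteq> 0" "f $ 0 = 0"
  shows "fls_deriv (fls_compose_fps g f) = fls_compose_fps (fls_deriv g) f * fps_to_fls (fps_deriv f)"
proof -
  let ?chain = "\<lambda>h. fls_deriv (fls_compose_fps h f)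
    = fls_compose_fps (fls_deriv h) f * fps_to_fls (fps_deriv f)"
  have chain: "?chain (fps_to_fls p)" for p
    using f by (simp add: fls_deriv_fps_to_fls fps_compose_deriv fls_times_fps_to_fls)
  define n where "n = nat (- fls_subdegree g)"
  define q where "q = fps_to_fls ((fps_X :: 'a fps) ^ n)"
  define p where "p = fls_regpart (g * q)"
  have "fls_subdegree (g * q) \<ge> 0"
    by (cases "g = 0") (simp_all add: q_def n_def fls_subdegree_fls_to_fps)
  hence p: "g * q = fps_to_fls p"
    by (simp add: p_def)
  have "q \<noteq> 0"
    by (simp add: q_def)
  hence "fls_compose_fps q f \<noteq> 0"
    by (simp add: fls_compose_fps_eq_0_iff f)
  moreover have "?chain (g * q)"
    unfolding p by (rule chain)
  moreover have "?chain q"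
    unfolding q_def by (rule chain)
  ultimately show ?thesis
    by (simp add: fls_compose_fps_mult fls_compose_fps_add f algebra_simps)
qed

text \<open>Dividing the new coefficient by \<open>fps_deriv f\<close> compensates the inner
  derivative of the chain rule.\<close>

lemma deriv_along_fls_compose_fps:
  assumes "f \<noteq> 0" "f $ 0 = 0" "fps_deriv f \<noteq> 0"
  shows "fls_compose_fps (deriv_along a g) f
    = deriv_along (fls_compose_fps a f / fps_to_fls (fps_deriv f)) (fls_compose_fps g f)"
  using assms by (simp add: deriv_along_def fls_compose_fps_mult fls_deriv_fls_compose_fps)

lemma funpow_deriv_along_fls_compose_fps:
  assumes "f \<noteq> 0" "f $ 0 = 0" "fps_deriv f \<noteq> 0"
  shows "fls_compose_fps ((deriv_along a ^^ n) g) f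
    = (deriv_along (fls_compose_fps a f / fps_to_fls (fps_deriv f)) ^^ n) (fls_compose_fps g f)"
  using assms by (induction n) (simp_all add: deriv_along_fls_compose_fps)

theorem lemma2p13:
  fixes \<phi> :: "complex fls fps" and f :: "complex fps"
  assumes "additive_associate \<phi>"
    and "fps_nth f 0 = 0"
    and "fps_nth (fps_deriv f) 0 \<noteq> 0"
  shows "additive_associate (conj_associate f \<phi>)"
proof -
  have f: "f \<noteq> 0" "f $ 0 = 0" "f $ 1 \<noteq> 0" "fps_deriv f \<noteq> 0"
    using assms(2,3) by auto
  obtain a where a: "\<phi> = flow a fls_X"
    using assms(1) by (auto simp: additive_associate_iff_flow)
  define b where "b = fls_compose_fps a f / fps_to_fls (fps_deriv f)"
  \<comment> \<open>Composition with \<open>f\<close> fixes the constants \<open>fact n\<close> in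
    the denominators and sends \<open>fls_X\<close> to \<open>f\<close>.\<close>
  have "fls_compose_fps (\<phi> $ n) f = flow b (fps_to_fls f) $ n" for n
    using fls_compose_fps_of_nat[of "fact n" f]
    by (simp add: a b_def flow_nth fls_compose_fps_divide f funpow_deriv_along_fls_compose_fps)
  hence "Abs_fps (\<lambda>n. fls_compose_fps (\<phi> $ n) f) = flow b (fps_to_fls f)"
    by (simp add: fps_eq_iff)
  hence "conj_associate f \<phi> = flow b (fls_compose_fps (fps_to_fls (fps_inv f)) f)"
    by (simp add: conj_associate_def fls_subst_flow f)
  also have "\<dots> = flow b fls_X"
    using f by (simp add: fps_inv)
  finally show ?thesis
    by (auto simp: additive_associate_iff_flow)
qed

end
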